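(* Let $A\subset\mathbb{N}$ be finite and let $n\in\mathbb{N}$ be such that $n\notin A$ and $n>a$ for every $a\in A$. Then $\Pr(A\cup\{n\})\subset\Pr(A)$.
   Context: For $m\in\mathbb{N}$, $D(m)$ is the set of positive divisors of $m$. For $A\subset\mathbb{N}$, $S_A=\sum_{a\in A}a$ ($S_\emptyset=0$), and $A$ is a practical set if every non-negative integer $k\le S_A$ is a sum of distinct elements of $A$. A number $m\in\mathbb{N}$ is $A$-practical if $D(m)\cap A$ is a practical set, and $\Pr(A)$ is the set of all $A$-practical numbers. *)

theory Defs
  imports Main
begin

(* Convention: the natural numbers of the paper are the positive integers.  They are
   modelled by the type nat, with explicit positivity conditions. *)

definition pos_divisors :: "nat \<Rightarrow> nat set" where
  "pos_divisors m = {d. 0 < d \<and> d dvd m}"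

(* For infinite A the sum S_A is infinite, so the bound k \<le> S_A is vacuous; HOL's
   sum over an infinite set is 0, hence the guard on finiteness.  A subset B of A
   encodes a sum of distinct elements of A; the empty sum represents 0. *)
definition practical_set :: "nat set \<Rightarrow> bool" where
  "practical_set A \<longleftrightarrow>
     (\<forall>k. (finite A \<longrightarrow> k \<le> \<Sum>A) \<longrightarrow> (\<exists>B. B \<subseteq> A \<and> finite B \<and> k = \<Sum>B))"

definition set_practical :: "nat set \<Rightarrow> nat \<Rightarrow> bool" where
  "set_practical A m \<longleftrightarrow> practical_set (pos_divisors m \<inter> A)"

definition practical_numbers :: "nat set \<Rightarrow> nat set" where
  "practical_numbers A = {m. 0 < m \<and> set_practical A m}"

end

theory Submission
  imports Defs
begin

text \<open>An integer below the largest element of a set can only be a sum of the smaller elements.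
  Hence, removing the elements of a practical set from the top, the representations of small
  integers survive; in particular, the predecessor of each element b is a sum of elements below b,
  and adding b to sums of smaller elements leaves no gap.\<close>

lemma subset_sum_below_element:
  fixes B C :: "nat set"
  assumes "finite C" "B \<subseteq> insert b C" "\<Sum>B < b"
  shows "B \<subseteq> C"
proof -
  have "finite B"
    using assms(1,2) finite_subset by blast
  then have "b \<notin> B"
    using member_le_sum[of b B "\<lambda>x. x"] assms(3) by fastforce
  then show ?thesis
    using assms(2) by blast
qed

text \<open>Each element \<open>b\<close> is at most one more than the sum of the elements below it,
  because \<open>b - 1\<close> is a sum of such elements; so the range of subset sums grows without
  a gap. The bound \<open>n\<close> makes the assumption weak enough to pass to \<open>C\<close>
  when the maximum is removed.\<close>

lemma practical_set_if_small_subset_sums: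
  fixes C :: "nat set"
  assumes "finite C" "\<forall>a\<in>C. a < n"
    and "\<And>k. k < n \<Longrightarrow> k \<le> \<Sum>C \<Longrightarrow> \<exists>B\<subseteq>C. k = \<Sum>B"
  shows "practical_set C"
  using assms
\<comment> \<open>\<open>n\<close> is generalized because the removed maximum \<open>b\<close>
  becomes the bound for the remaining set.\<close>
proof (induction C arbitrary: n rule: finite_linorder_max_induct)
  case empty
  then show ?case
    by (simp add: practical_set_def)
next
  case (insert b C)
  have "b \<notin> C"
    using insert.hyps(2) by blast
  then have sum_insert: "\<Sum>(insert b D) = b + \<Sum>D" if "D \<subseteq> C" for D
    using that insert.hyps(1) finite_subset[of D C] by (subst sum.insert) auto
  have small: "\<exists>B\<subseteq>C. k = \<Sum>B" if "k < b" for k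
  proof -
    \<comment> \<open>Since \<open>b\<close> is itself a summand, \<open>k < b\<close> already gives
      the bound by the total.\<close>
    have "k < n" "k \<le> \<Sum>(insert b C)"
      using that insert.prems(1) sum_insert[of C] by auto
    then obtain B where "B \<subseteq> insert b C" "k = \<Sum>B"
      using insert.prems(2) by blast
    then show ?thesis
      using subset_sum_below_element[OF insert.hyps(1), of B b] that by auto
  qed
  have "practical_set C"
    using insert.IH[of b] insert.hyps(2) small by blast
  then have C: "\<exists>B\<subseteq>C. k = \<Sum>B" if "k \<le> \<Sum>C" for k
    using that unfolding practical_set_def by blast
  have b_le: "b \<le> Suc (\<Sum>C)"
  proof (cases b)
    case (Suc b')
    then obtain B where "B \<subseteq> C" "b' = \<Sum>B"
      using small by blast
    then show ?thesis
      using sum_mono2[OF insert.hyps(1), of B "\<lambda>x. x"] Suc by simp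
  qed simp
  have "\<exists>B\<subseteq>insert b C. k = \<Sum>B" if "k \<le> \<Sum>(insert b C)" for k
  proof (cases "k \<le> \<Sum>C")
    case True
    then show ?thesis
      using C by blast
  next
    case False
    \<comment> \<open>Here \<open>k\<close> is at least \<open>Suc (\<Sum>C)\<close>, hence at least
      \<open>b\<close>, so \<open>b\<close> can be split off.\<close>
    then have "b \<le> k" "k - b \<le> \<Sum>C"
      using b_le that sum_insert[of C] by auto
    then obtain B where "B \<subseteq> C" "k - b = \<Sum>B"
      using C by blast
    then have "insert b B \<subseteq> insert b C" "k = \<Sum>(insert b B)"
      using sum_insert \<open>b \<le> k\<close> by auto
    then show ?thesis
      by blast
  qed
  moreover have "finite B" if "B \<subseteq> insert b C" for B
    using that insert.hyps(1) by (simp add: finite_subset)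
  ultimately show ?case
    using insert.hyps(1) unfolding practical_set_def by (meson finite_insert)
qed

text \<open>By the previous criterion only targets below \<open>n\<close> matter, and their
  representations cannot use \<open>n\<close>.\<close>

lemma practical_set_remove_max:
  fixes C :: "nat set"
  assumes "finite C" "\<forall>a\<in>C. a < n" "practical_set (insert n C)"
  shows "practical_set C"
proof (rule practical_set_if_small_subset_sums[OF assms(1,2)])
  fix k assume "k < n" "k \<le> \<Sum>C"
  have "\<Sum>C \<le> \<Sum>(insert n C)"
    using assms(1) by (intro sum_mono2) auto
  then obtain B where "B \<subseteq> insert n C" "k = \<Sum>B"
    using assms(3) \<open>k \<le> \<Sum>C\<close> order_trans unfolding practical_set_def by blast
  then show "\<exists>B\<subseteq>C. k = \<Sum>B"
    using subset_sum_below_element[OF assms(1), of B n] \<open>k < n\<close> by auto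
qed

theorem theorem3p22:
  fixes A :: "nat set" and n :: nat
  assumes "finite A"
    and "\<forall>a\<in>A. 0 < a"
    and "0 < n"
    and "n \<notin> A"
    and "\<forall>a\<in>A. a < n"
  shows "practical_numbers (A \<union> {n}) \<subseteq> practical_numbers A"
proof
  fix m assume "m \<in> practical_numbers (A \<union> {n})"
  then have m: "0 < m" "practical_set (pos_divisors m \<inter> (A \<union> {n}))"
    by (auto simp: practical_numbers_def set_practical_def)
  have "practical_set (pos_divisors m \<inter> A)"
  \<comment> \<open>Either \<open>n\<close> divides \<open>m\<close> and is the maximum of the
    enlarged set of divisors, or adjoining \<open>n\<close> to \<open>A\<close> leaves that set
    unchanged.\<close>
  proof (cases "n \<in> pos_divisors m")
    case True
    then have "practical_set (insert n (pos_divisors m \<inter> A))"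
      using m(2) by (simp add: Int_Un_distrib)
    then show ?thesis
      using practical_set_remove_max[of "pos_divisors m \<inter> A" n] assms(1,5) by blast
  next
    case False
    then show ?thesis
      using m(2) by (simp add: Int_Un_distrib)
  qed
  then show "m \<in> practical_numbers A"
    using m(1) by (simp add: practical_numbers_def set_practical_def)
qed

end
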